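(* Let $\boldsymbol{X}=(X_1,\dots,X_d)$ follow the multivariate thinning-dependence Poisson distribution with background Poisson random variables $Y_1,\dots,Y_l$ of rates $\theta_1,\dots,\theta_l$ and thinning probabilities $p_j^k$, and let $M^{\boldsymbol X}=\max(X_1,\dots,X_d)$, $m^{\boldsymbol X}=\min(X_1,\dots,X_d)$. Then for every $x\in\mathbb N=\{0,1,2,\dots\}$ the cumulative distribution functions of $M^{\boldsymbol X}$ and $m^{\boldsymbol X}$ are $$F_{M^{\boldsymbol X}}(x)=\sum_{y_1+\cdots+y_l\le x}\ \prod_{k=1}^{l}\frac{\theta_k^{y_k}e^{-\theta_k}}{\Gamma(y_k+1)}+\sum_{y_1+\cdots+y_l\ge x+1}\left\{\left[\prod_{j=1}^{d}\sum_{s=0}^{x}h_j(s,y_1,\dots,y_l)\right]\left[\prod_{k=1}^{l}\frac{\theta_k^{y_k}e^{-\theta_k}}{\Gamma(y_k+1)}\right]\right\}$$ and $$F_{m^{\boldsymbol X}}(x)=\sum_{y_1+\cdots+y_l\le x}\ \prod_{k=1}^{l}\frac{\theta_k^{y_k}e^{-\theta_k}}{\Gamma(y_k+1)}+\sum_{y_1+\cdots+y_l\ge x+1}\left\{\left[1-\prod_{j=1}^{d}\left(1-\sum_{s=0}^{x}h_j(s,y_1,\dots,y_l)\right)\right]\left[\prod_{k=1}^{l}\frac{\theta_k^{y_k}e^{-\theta_k}}{\Gamma(y_k+1)}\right]\right\},$$ where the sums range over $(y_1,\dots,y_l)\in\mathbb N^l$ and $h_j(s,y_1,\dots,y_l)=\mathbb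 P(X_j=s\mid Y_1=y_1,\dots,Y_l=y_l)$, which for $s\le y_1+\cdots+y_l$ is given explicitly by $$h_j(s,y_1,\dots,y_l)=\sum_{x^1=L_1}^{U_1}\ \sum_{x^2=L_2}^{U_2}\cdots\sum_{x^{l-1}=L_{l-1}}^{U_{l-1}}\ \left[\prod_{k=1}^{l-1}\mathbb P(X_j^k=x^k\mid Y_k=y_k)\right]\mathbb P\Big(X_j^l=s-\sum_{i=1}^{l-1}x^i\ \Big|\ Y_l=y_l\Big),$$ with $L_k=\max\big(0,\ s-\sum_{i=1}^{k-1}x^i-\sum_{i=k+1}^{l}y_i\big)$ and $U_k=\min\big(s-\sum_{i=1}^{k-1}x^i,\ y_k\big)$ for $k=1,\dots,l-1$.
   Context: Multivariate thinning-dependence Poisson distribution: let $Y_1,\dots,Y_l$ be independent Poisson random variables with rates $\theta_1,\dots,\theta_l>0$, let $p_j^k\in[0,1]$ for $j=1,\dots,d$, $k=1,\dots,l$, and let $\boldsymbol X=(X_1,\dots,X_d)$ with $X_j=\sum_{k=1}^{l}X_j^k$. The vector $\boldsymbol X$ follows the multivariate thinning-dependence Poisson distribution if: (i) conditionally on $Y_k=y_k$, $X_j^k$ is binomial with parameters $y_k$ and $p_j^k$, i.e. $\mathbb P(X_j^k=z\mid Y_k=y_k)=\binom{y_k}{z}(p_j^k)^z(1-p_j^k)^{y_k-z}$ for $0\le z\le y_k$; (ii) for each $k$, $X_1^k,\dots,X_d^k$ are conditionally independent given $Y_k=y_k$; (iii) the $l$ random vectors $(Y_1,X_1^1,\dots,X_d^1),\dots,(Y_l,X_1^l,\dots,X_d^l)$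 are independent. *)

theory Defs
  imports "HOL-Probability.Probability"
begin

text \<open>
  \<open>Y k\<close> are the background Poisson variables, \<open>Z j k\<close> is the thinned variable
  $X_j^k$, and \<open>p j k\<close> is $p_j^k$; all indices start at 1.  Conditioning on
  \<open>Y k = y\<close> in the conditional independence requirement is expressed by passing to the
  conditional measure \<open>uniform_measure M {Y k = y}\<close>; the event has positive probability
  because \<open>\<theta> k > 0\<close>.
\<close>

locale thinning_dependence_poisson = prob_space M
  for M :: "'a measure" +
  fixes d l :: nat
    and \<theta> :: "nat \<Rightarrow> real"
    and p :: "nat \<Rightarrow> nat \<Rightarrow> real"
    and Y :: "nat \<Rightarrow> 'a \<Rightarrow> nat"
    and Z :: "nat \<Rightarrow> nat \<Rightarrow> 'a \<Rightarrow> nat"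
    and X :: "nat \<Rightarrow> 'a \<Rightarrow> nat"
  assumes d_pos: "1 \<le> d"
    and l_pos: "1 \<le> l"
    and rate_pos: "\<And>k. k \<in> {1..l} \<Longrightarrow> 0 < \<theta> k"
    and thinning_prob: "\<And>j k. j \<in> {1..d} \<Longrightarrow> k \<in> {1..l} \<Longrightarrow> p j k \<in> {0..1}"
    and Y_measurable: "\<And>k. k \<in> {1..l} \<Longrightarrow> random_variable (count_space UNIV) (Y k)"
    and Y_poisson: "\<And>k. k \<in> {1..l} \<Longrightarrow>
          distr M (count_space UNIV) (Y k) = measure_pmf (poisson_pmf (\<theta> k))"
    and Y_indep: "indep_vars (\<lambda>_. count_space UNIV) Y {1..l}"
    and Z_measurable: "\<And>j k. j \<in> {1..d} \<Longrightarrow> k \<in> {1..l} \<Longrightarrow>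
          random_variable (count_space UNIV) (Z j k)"
    and X_eq: "\<And>j \<omega>. j \<in> {1..d} \<Longrightarrow> \<omega> \<in> space M \<Longrightarrow> X j \<omega> = (\<Sum>k=1..l. Z j k \<omega>)"
    and cond_binomial: "\<And>j k y z. j \<in> {1..d} \<Longrightarrow> k \<in> {1..l} \<Longrightarrow> z \<le> y \<Longrightarrow>
          \<P>(\<omega> in M. Z j k \<omega> = z \<bar> Y k \<omega> = y) =
            real (y choose z) * p j k ^ z * (1 - p j k) ^ (y - z)"
    and cond_indep: "\<And>k y. k \<in> {1..l} \<Longrightarrow>
          prob_space.indep_vars (uniform_measure M {\<omega> \<in> space M. Y k \<omega> = y})
            (\<lambda>_. count_space UNIV) (\<lambda>j. Z j k) {1..d}"
    and vectors_indep: "indep_vars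
          (\<lambda>_. count_space UNIV \<Otimes>\<^sub>M (\<Pi>\<^sub>M j\<in>{1..d}. count_space UNIV))
          (\<lambda>k \<omega>. (Y k \<omega>, \<lambda>j\<in>{1..d}. Z j k \<omega>)) {1..l}"

text \<open>$\mathbb N^l$, as functions on \<open>{1..l}\<close>.\<close>

definition nat_tuples :: "nat \<Rightarrow> (nat \<Rightarrow> nat) set" where
  "nat_tuples l = {1..l} \<rightarrow>\<^sub>E UNIV"

definition poisson_weight :: "nat \<Rightarrow> (nat \<Rightarrow> real) \<Rightarrow> (nat \<Rightarrow> nat) \<Rightarrow> real" where
  "poisson_weight l \<theta> y = (\<Prod>k=1..l. \<theta> k ^ y k * exp (- \<theta> k) / Gamma (real (y k) + 1))"

definition cond_mass ::
    "'a measure \<Rightarrow> nat \<Rightarrow> (nat \<Rightarrow> 'a \<Rightarrow> nat) \<Rightarrow> (nat \<Rightarrow> 'a \<Rightarrow> nat) \<Rightarrow> nat \<Rightarrow> nat \<Rightarrow> (nat \<Rightarrow> nat) \<Rightarrow> real" where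
  "cond_mass M l Y X j s y = \<P>(\<omega> in M. X j \<omega> = s \<bar> (\<forall>k\<in>{1..l}. Y k \<omega> = y k))"

text \<open>
  \<open>iterated_sum L U g k n x\<close> is the \<open>n\<close>-fold sum
  $\sum_{x^k=L_k}^{U_k}\cdots\sum_{x^{k+n-1}=L_{k+n-1}}^{U_{k+n-1}} g(x)$, where the bounds of
  each sum may depend on the summation variables already chosen.
\<close>

primrec iterated_sum ::
    "(nat \<Rightarrow> (nat \<Rightarrow> int) \<Rightarrow> int) \<Rightarrow> (nat \<Rightarrow> (nat \<Rightarrow> int) \<Rightarrow> int) \<Rightarrow> ((nat \<Rightarrow> int) \<Rightarrow> real) \<Rightarrow>
     nat \<Rightarrow> nat \<Rightarrow> (nat \<Rightarrow> int) \<Rightarrow> real" where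
  "iterated_sum L U g k 0 x = g x"
| "iterated_sum L U g k (Suc n) x =
     (\<Sum>v = L k x..U k x. iterated_sum L U g (Suc k) n (x(k := v)))"

text \<open>The bounds are computed over the integers, so that subtraction is not truncated.\<close>

definition lower_bound :: "nat \<Rightarrow> nat \<Rightarrow> (nat \<Rightarrow> nat) \<Rightarrow> nat \<Rightarrow> (nat \<Rightarrow> int) \<Rightarrow> int" where
  "lower_bound l s y k x = max 0 (int s - (\<Sum>i=1..<k. x i) - (\<Sum>i=k+1..l. int (y i)))"

definition upper_bound :: "nat \<Rightarrow> (nat \<Rightarrow> nat) \<Rightarrow> nat \<Rightarrow> (nat \<Rightarrow> int) \<Rightarrow> int" where
  "upper_bound s y k x = min (int s - (\<Sum>i=1..<k. x i)) (int (y k))"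

definition explicit_mass ::
    "'a measure \<Rightarrow> nat \<Rightarrow> (nat \<Rightarrow> 'a \<Rightarrow> nat) \<Rightarrow> (nat \<Rightarrow> nat \<Rightarrow> 'a \<Rightarrow> nat) \<Rightarrow>
     nat \<Rightarrow> nat \<Rightarrow> (nat \<Rightarrow> nat) \<Rightarrow> real" where
  "explicit_mass M l Y Z j s y =
     iterated_sum (lower_bound l s y) (upper_bound s y)
       (\<lambda>x. (\<Prod>k=1..<l. \<P>(\<omega> in M. int (Z j k \<omega>) = x k \<bar> Y k \<omega> = y k)) *
            \<P>(\<omega> in M. int (Z j l \<omega>) = int s - (\<Sum>i=1..<l. x i) \<bar> Y l \<omega> = y l))
       1 (l - 1) (\<lambda>_. 0)"

end

theory Submission imports Defs begin

text \<open>
  Condition on the whole background vector, \<open>Y = y\<close>.  Independence of the \<open>l\<close> blocks together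
  with the conditional independence inside each block makes all the \<open>Z j k\<close> independent under
  the conditional measure, each with its binomial law given \<open>Y k = y k\<close>.  Hence the \<open>X j\<close> are
  conditionally independent, and the conditional probabilities of \<open>max X \<le> x\<close> and \<open>min X > x\<close>
  factor over \<open>j\<close>.  Thinning gives \<open>X j \<le> y\<^sub>1 + \<dots> + y\<^sub>l\<close> almost surely, so both conditional
  distribution functions are \<open>1\<close> at \<open>x\<close> when \<open>y\<^sub>1 + \<dots> + y\<^sub>l \<le> x\<close>; the law of total probability
  gives the two formulas.  The explicit mass function is the iterated convolution of the laws of
  \<open>Z j 1, \<dots>, Z j l\<close>, the bounds \<open>L\<^sub>k\<close>, \<open>U\<^sub>k\<close> discarding only null terms.
\<close>

section \<open>Countable additivity and convolution\<close>

text \<open>Sigma-additivity along sequences is transported by the enumeration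
  \<open>to_nat_on I\<close>; nonnegative terms allow passing from \<open>sums\<close> to the
  order-free \<open>has_sum\<close>. This fits sums over \<open>nat_tuples l\<close>, which has no
  natural order.\<close>

lemma (in finite_measure) has_sum_measure_UN:
  assumes I: "countable I" and A: "\<And>i. i \<in> I \<Longrightarrow> A i \<in> sets M" and disj: "disjoint_family_on A I"
  shows "((\<lambda>i. measure M (A i)) has_sum measure M (\<Union>i\<in>I. A i)) I"
proof -
  define T where "T = to_nat_on I ` I"
  \<comment> \<open>Padding with empty sets covers finite \<open>I\<close>, whose enumeration does
    not exhaust the naturals.\<close>
  define A' where "A' n = (if n \<in> T then A (from_nat_into I n) else {})" for n
  have A'_to: "A' (to_nat_on I i) = A i" if "i \<in> I" for i
    using that I by (simp add: A'_def T_def)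
  have UN: "(\<Union>n. A' n) = (\<Union>i\<in>I. A i)"
    using A'_to I by (auto simp: A'_def T_def split: if_splits)
  have sets: "range A' \<subseteq> sets M"
    using A I by (auto simp: A'_def T_def)
  have "disjoint_family A'"
    unfolding disjoint_family_on_def
  proof (intro ballI impI)
    fix m n :: nat assume "m \<noteq> n"
    show "A' m \<inter> A' n = {}"
    proof (cases "m \<in> T \<and> n \<in> T")
      case True
      then obtain i j where "i \<in> I" "j \<in> I" "m = to_nat_on I i" "n = to_nat_on I j"
        by (auto simp: T_def)
      then show ?thesis
        using A'_to \<open>m \<noteq> n\<close> disjoint_family_onD[OF disj] by metis
    qed (auto simp: A'_def)
  qed
  with sets have "(\<lambda>n. measure M (A' n)) sums measure M (\<Union>n. A' n)"
    by (intro measure_UNION) auto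
  then have "((\<lambda>n. measure M (A' n)) has_sum measure M (\<Union>n. A' n)) UNIV"
    by (intro sums_nonneg_imp_has_sum) auto
  also have "?this \<longleftrightarrow> ((\<lambda>n. measure M (A' n)) has_sum measure M (\<Union>n. A' n)) T"
    by (rule has_sum_cong_neutral) (auto simp: A'_def)
  also have "\<dots> \<longleftrightarrow> (((\<lambda>n. measure M (A' n)) \<circ> to_nat_on I) has_sum measure M (\<Union>n. A' n)) I"
    unfolding T_def by (rule has_sum_reindex) (simp add: I inj_on_to_nat_on)
  also have "\<dots> \<longleftrightarrow> ((\<lambda>i. measure M (A i)) has_sum measure M (\<Union>n. A' n)) I"
    by (rule has_sum_cong) (simp add: A'_to)
  finally show ?thesis
    by (simp add: UN)
qed

text \<open>Discrete convolution: the summation range consists of exactly those \<open>v\<close>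
  with \<open>0 \<le> v \<le> a\<close> and \<open>0 \<le> r - v \<le> b\<close>. With
  \<open>r\<close> an integer it is empty for negative \<open>r\<close>, where both sides
  vanish.\<close>

lemma (in prob_space) prob_add_eq_sum:
  fixes V W :: "'a \<Rightarrow> nat"
  assumes indep: "indep_var (count_space UNIV) V (count_space UNIV) W"
    and V_le: "AE \<omega> in M. V \<omega> \<le> a" and W_le: "AE \<omega> in M. W \<omega> \<le> b"
  shows "\<P>(\<omega> in M. int (V \<omega> + W \<omega>) = r) =
    (\<Sum>v = max 0 (r - int b)..min r (int a). \<P>(\<omega> in M. int (V \<omega>) = v) * \<P>(\<omega> in M. int (W \<omega>) = r - v))"
proof -
  have [measurable]: "V \<in> measurable M (count_space UNIV)" "W \<in> measurable M (count_space UNIV)"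
    using indep_var_rv1[OF indep] indep_var_rv2[OF indep] by auto
  let ?I = "{max 0 (r - int b)..min r (int a)}"
  let ?E = "\<lambda>v. {\<omega> \<in> space M. int (V \<omega>) = v \<and> int (W \<omega>) = r - v}"
  have [measurable]: "?E v \<in> sets M" for v by measurable
  \<comment> \<open>The bounds on \<open>V\<close> and \<open>W\<close> hold only almost surely, so
    the two events agree up to a null set.\<close>
  have "\<P>(\<omega> in M. int (V \<omega> + W \<omega>) = r) = prob (\<Union>v\<in>?I. ?E v)"
  proof (rule finite_measure_eq_AE)
    show "AE \<omega> in M. (\<omega> \<in> {\<omega> \<in> space M. int (V \<omega> + W \<omega>) = r}) = (\<omega> \<in> (\<Union>v\<in>?I. ?E v))"
      using V_le W_le by eventually_elim auto
  qed measurable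
  also have "\<dots> = (\<Sum>v\<in>?I. prob (?E v))"
    by (rule finite_measure_finite_Union) (auto simp: disjoint_family_on_def)
  also have "\<dots> = (\<Sum>v\<in>?I. \<P>(\<omega> in M. int (V \<omega>) = v) * \<P>(\<omega> in M. int (W \<omega>) = r - v))"
  proof (rule sum.cong[OF refl])
    fix v assume "v \<in> ?I"
    show "prob (?E v) = \<P>(\<omega> in M. int (V \<omega>) = v) * \<P>(\<omega> in M. int (W \<omega>) = r - v)"
      using indep_varD[OF indep, of "{n. int n = v}" "{n. int n = r - v}"]
      by (simp add: vimage_def Int_def conj_ac)
  qed
  finally show ?thesis .
qed

text \<open>
  Holds for an arbitrary already chosen prefix \<open>x\<close>, possible or not, which is what makes the
  induction on the number of remaining sums work.
\<close>

lemma (in prob_space) iterated_sum_eq_prob_sum: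
  fixes W :: "nat \<Rightarrow> 'a \<Rightarrow> nat"
  assumes indep: "indep_vars (\<lambda>_. count_space UNIV) W {1..l}"
    and W_le: "\<And>i. i \<in> {1..l} \<Longrightarrow> AE \<omega> in M. W i \<omega> \<le> y i"
    and "1 \<le> k" "k + n = l"
  shows "iterated_sum (lower_bound l s y) (upper_bound s y)
      (\<lambda>x. (\<Prod>i=1..<l. \<P>(\<omega> in M. int (W i \<omega>) = x i)) *
            \<P>(\<omega> in M. int (W l \<omega>) = int s - (\<Sum>i=1..<l. x i))) k n x =
    (\<Prod>i=1..<k. \<P>(\<omega> in M. int (W i \<omega>) = x i)) *
      \<P>(\<omega> in M. int (\<Sum>i=k..l. W i \<omega>) = int s - (\<Sum>i=1..<k. x i))"
  using assms(3-)
proof (induction n arbitrary: k x)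
  \<comment> \<open>Here \<open>k = l\<close>: only \<open>W l\<close> is left and the two sides
    coincide literally.\<close>
  case 0
  then show ?case by simp
next
  case (Suc n)
  define r where "r = int s - (\<Sum>i=1..<k. x i)"
  define P where "P i v = \<P>(\<omega> in M. int (W i \<omega>) = v)" for i v
  \<comment> \<open>Groups over the disjoint index sets \<open>{k}\<close> and
    \<open>{Suc k..l}\<close> are independent; evaluating the first and summing the second preserves
    this.\<close>
  have "indep_var (PiM {k} (\<lambda>_. count_space UNIV)) (\<lambda>\<omega>. restrict (\<lambda>i. W i \<omega>) {k})
     (PiM {Suc k..l} (\<lambda>_. count_space UNIV)) (\<lambda>\<omega>. restrict (\<lambda>i. W i \<omega>) {Suc k..l})"
    using Suc.prems by (intro indep_var_restrict[OF indep]) auto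
  then have "indep_var (count_space UNIV) ((\<lambda>f. f k) \<circ> (\<lambda>\<omega>. restrict (\<lambda>i. W i \<omega>) {k}))
     (count_space UNIV) ((\<lambda>f. \<Sum>i=Suc k..l. f i) \<circ> (\<lambda>\<omega>. restrict (\<lambda>i. W i \<omega>) {Suc k..l}))"
    by (rule indep_var_compose) measurable
  then have split: "indep_var (count_space UNIV) (W k)
     (count_space UNIV) (\<lambda>\<omega>. \<Sum>i=Suc k..l. W i \<omega>)"
    by (simp add: comp_def)
  have Wk: "AE \<omega> in M. W k \<omega> \<le> y k"
    using Suc.prems by (intro W_le) auto
  have "AE \<omega> in M. \<forall>i\<in>{Suc k..l}. W i \<omega> \<le> y i"
    by (intro AE_ball_countable[THEN iffD2] ballI W_le) auto
  then have rest: "AE \<omega> in M. (\<Sum>i=Suc k..l. W i \<omega>) \<le> (\<Sum>i=Suc k..l. y i)"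
    by eventually_elim (auto intro: sum_mono)
  \<comment> \<open>Fixing \<open>x k\<close> to \<open>v\<close> adds the factor
    \<open>P k v\<close> to the prefix and lowers the remaining target from \<open>r\<close> to
    \<open>r - v\<close>.\<close>
  have IH: "iterated_sum (lower_bound l s y) (upper_bound s y)
      (\<lambda>x. (\<Prod>i=1..<l. P i (x i)) * P l (int s - (\<Sum>i=1..<l. x i))) (Suc k) n (x(k := v)) =
     (\<Prod>i=1..<k. P i (x i)) * (P k v * \<P>(\<omega> in M. int (\<Sum>i=Suc k..l. W i \<omega>) = r - v))" for v
  proof -
    have "(\<Prod>i=1..<Suc k. P i ((x(k := v)) i)) = (\<Prod>i=1..<k. P i (x i)) * P k v"
      using Suc.prems by simp
    moreover have "int s - (\<Sum>i=1..<Suc k. (x(k := v)) i) = r - v"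
      using Suc.prems by (simp add: r_def)
    ultimately show ?thesis
      using Suc.IH[of "Suc k" "x(k := v)", folded P_def] Suc.prems
      by (simp only: mult.assoc)
  qed
  have "{\<omega> \<in> space M. int (\<Sum>i=k..l. W i \<omega>) = r} =
    {\<omega> \<in> space M. int (W k \<omega> + (\<Sum>i=Suc k..l. W i \<omega>)) = r}"
    using Suc.prems by (simp add: sum.atLeast_Suc_atMost)
  then have "\<P>(\<omega> in M. int (\<Sum>i=k..l. W i \<omega>) = r) =
      (\<Sum>v = max 0 (r - int (\<Sum>i=Suc k..l. y i))..min r (int (y k)).
         P k v * \<P>(\<omega> in M. int (\<Sum>i=Suc k..l. W i \<omega>) = r - v))"
    unfolding P_def using prob_add_eq_sum[OF split Wk rest, of r] by simp
  \<comment> \<open>The prescribed bounds are the convolution bounds for the target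
    \<open>r\<close>, with the sum of the later \<open>y i\<close> capping the remaining
    variables.\<close>
  moreover have "lower_bound l s y k x = max 0 (r - int (\<Sum>i=Suc k..l. y i))"
    "upper_bound s y k x = min r (int (y k))"
    by (simp_all add: lower_bound_def upper_bound_def r_def)
  ultimately show ?case
    unfolding P_def[symmetric] r_def[symmetric] iterated_sum.simps IH
    by (simp only: sum_distrib_left)
qed

section \<open>Conditioning on the background vector\<close>

context thinning_dependence_poisson
begin

definition background_event :: "(nat \<Rightarrow> nat) \<Rightarrow> 'a set" where
  "background_event y = {\<omega> \<in> space M. \<forall>k\<in>{1..l}. Y k \<omega> = y k}"

text \<open>Conditioning becomes a probability measure of its own, so that independence and almost
  sure statements apply to it directly.\<close>

definition cond_measure :: "(nat \<Rightarrow> nat) \<Rightarrow> 'a measure" where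
  "cond_measure y = uniform_measure M (background_event y)"

lemma measurable_X: "j \<in> {1..d} \<Longrightarrow> X j \<in> measurable M (count_space UNIV)"
proof -
  assume j: "j \<in> {1..d}"
  have "(\<lambda>\<omega>. \<Sum>k=1..l. Z j k \<omega>) \<in> measurable M (count_space UNIV)"
    using Z_measurable[OF j] by measurable
  also have "?this \<longleftrightarrow> ?thesis"
    using X_eq[OF j] by (intro measurable_cong) simp
  finally show ?thesis .
qed

lemma sets_background_event [measurable]: "background_event y \<in> sets M"
proof -
  note Y_measurable[measurable]
  show ?thesis unfolding background_event_def by measurable
qed

lemma prob_Y: "k \<in> {1..l} \<Longrightarrow> \<P>(\<omega> in M. Y k \<omega> = n) = pmf (poisson_pmf (\<theta> k)) n"
proof -
  assume k: "k \<in> {1..l}"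
  have "pmf (poisson_pmf (\<theta> k)) n = measure (distr M (count_space UNIV) (Y k)) {n}"
    using Y_poisson[OF k] by (simp add: pmf.rep_eq)
  also have "\<dots> = \<P>(\<omega> in M. Y k \<omega> = n)"
    using Y_measurable[OF k] by (simp add: measure_distr vimage_def Int_def conj_commute)
  finally show ?thesis by simp
qed

lemma prob_Y_pos: "k \<in> {1..l} \<Longrightarrow> \<P>(\<omega> in M. Y k \<omega> = n) > 0"
  using rate_pos[of k] by (simp add: prob_Y)

section \<open>Factorisation over blocks and within a block\<close>

text \<open>Independence of the \<open>l\<close> random vectors, evaluated on measurable
  rectangles.\<close>

lemma prob_blocks:
  "\<P>(\<omega> in M. \<forall>k\<in>{1..l}. Y k \<omega> = y k \<and> (\<forall>j\<in>{1..d}. Z j k \<omega> \<in> A j k)) =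
    (\<Prod>k=1..l. \<P>(\<omega> in M. Y k \<omega> = y k \<and> (\<forall>j\<in>{1..d}. Z j k \<omega> \<in> A j k)))"
proof -
  let ?V = "\<lambda>k \<omega>. (Y k \<omega>, \<lambda>j\<in>{1..d}. Z j k \<omega>)"
  let ?B = "\<lambda>k. {y k} \<times> (\<Pi>\<^sub>E j\<in>{1..d}. A j k)"
  have block: "?V k -` ?B k \<inter> space M =
      {\<omega> \<in> space M. Y k \<omega> = y k \<and> (\<forall>j\<in>{1..d}. Z j k \<omega> \<in> A j k)}" for k
    by (auto simp: PiE_iff)
  have "prob (\<Inter>k\<in>{1..l}. ?V k -` ?B k \<inter> space M) = (\<Prod>k=1..l. prob (?V k -` ?B k \<inter> space M))"
  proof (rule indep_varsD_finite[OF vectors_indep])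
    show "?B k \<in> sets (count_space UNIV \<Otimes>\<^sub>M (\<Pi>\<^sub>M j\<in>{1..d}. count_space UNIV))" for k
      by (intro pair_measureI sets_PiM_I_finite) auto
  qed (use l_pos in auto)
  moreover have "(\<Inter>k\<in>{1..l}. ?V k -` ?B k \<inter> space M) =
      {\<omega> \<in> space M. \<forall>k\<in>{1..l}. Y k \<omega> = y k \<and> (\<forall>j\<in>{1..d}. Z j k \<omega> \<in> A j k)}"
    unfolding block using l_pos by auto
  ultimately show ?thesis
    unfolding block by simp
qed

lemma prob_background_event: "prob (background_event y) = (\<Prod>k=1..l. \<P>(\<omega> in M. Y k \<omega> = y k))"
  using prob_blocks[of y "\<lambda>_ _. UNIV"] by (simp add: background_event_def)

lemma prob_background_event_pos: "prob (background_event y) > 0"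
  unfolding prob_background_event by (intro prod_pos prob_Y_pos)

text \<open>Each factor is a Poisson mass, since \<open>Gamma (n + 1) = fact n\<close>.\<close>

lemma prob_background_event_eq_poisson_weight: "prob (background_event y) = poisson_weight l \<theta> y"
  unfolding prob_background_event poisson_weight_def
proof (rule prod.cong[OF refl])
  fix k assume k: "k \<in> {1..l}"
  show "\<P>(\<omega> in M. Y k \<omega> = y k) = \<theta> k ^ y k * exp (- \<theta> k) / Gamma (real (y k) + 1)"
    using rate_pos[OF k] Gamma_fact[of "y k", where 'a = real] by (simp add: prob_Y[OF k] add.commute)
qed

text \<open>Conditional independence given \<open>Y k = n\<close>, multiplied through by the
  positive probability of that event.\<close>

lemma prob_block:
  assumes k: "k \<in> {1..l}"
  shows "\<P>(\<omega> in M. Y k \<omega> = n \<and> (\<forall>j\<in>{1..d}. Z j k \<omega> \<in> A j)) =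
    \<P>(\<omega> in M. Y k \<omega> = n) * (\<Prod>j=1..d. \<P>(\<omega> in M. Z j k \<omega> \<in> A j \<bar> Y k \<omega> = n))"
proof -
  let ?E = "{\<omega> \<in> space M. Y k \<omega> = n}"
  let ?U = "uniform_measure M ?E"
  note Y_measurable[OF k, measurable]
  have Z[measurable]: "Z j k \<in> measurable M (count_space UNIV)" if "j \<in> {1..d}" for j
    using Z_measurable[OF that k] .
  have pos: "emeasure M ?E \<noteq> 0" "emeasure M ?E \<noteq> \<infinity>"
    using prob_Y_pos[OF k, of n] by (auto simp: emeasure_eq_measure)
  interpret U: prob_space ?U
    by (rule prob_space_uniform_measure[OF pos])
  have [measurable]: "{\<omega> \<in> space M. \<forall>j\<in>{1..d}. Z j k \<omega> \<in> A j} \<in> sets M"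
    by (intro sets.sets_Collect_finite_All) auto
  have "U.prob (\<Inter>j\<in>{1..d}. Z j k -` A j \<inter> space ?U) = (\<Prod>j=1..d. U.prob (Z j k -` A j \<inter> space ?U))"
    using d_pos by (intro U.indep_varsD_finite[OF cond_indep[OF k]]) auto
  also have "(\<Inter>j\<in>{1..d}. Z j k -` A j \<inter> space ?U) = {\<omega> \<in> space M. \<forall>j\<in>{1..d}. Z j k \<omega> \<in> A j}"
    using d_pos by auto
  also have "U.prob \<dots> = \<P>(\<omega> in M. Y k \<omega> = n \<and> (\<forall>j\<in>{1..d}. Z j k \<omega> \<in> A j)) / prob ?E"
    using pos by (simp add: Int_def conj_ac)
  also have "(\<Prod>j=1..d. U.prob (Z j k -` A j \<inter> space ?U)) =
      (\<Prod>j=1..d. \<P>(\<omega> in M. Z j k \<omega> \<in> A j \<bar> Y k \<omega> = n))"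
  proof (rule prod.cong[OF refl])
    fix j assume j: "j \<in> {1..d}"
    have "Z j k -` A j \<inter> space M \<in> sets M"
      using Z[OF j] by (rule measurable_sets) simp
    then show "U.prob (Z j k -` A j \<inter> space ?U) = \<P>(\<omega> in M. Z j k \<omega> \<in> A j \<bar> Y k \<omega> = n)"
      using pos by (simp add: cond_prob_def Int_def vimage_def conj_ac)
  qed
  finally show ?thesis
    using prob_Y_pos[OF k, of n] by (simp add: field_simps)
qed

section \<open>The thinned variables under the conditional measure\<close>

lemma prob_space_cond_measure: "prob_space (cond_measure y)"
  unfolding cond_measure_def using prob_background_event_pos[of y]
  by (intro prob_space_uniform_measure) (auto simp: emeasure_eq_measure)

lemma sets_cond_measure [simp, measurable_cong]: "sets (cond_measure y) = sets M"
  by (simp add: cond_measure_def)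

lemma space_cond_measure [simp]: "space (cond_measure y) = space M"
  by (simp add: cond_measure_def)

lemma measure_cond_measure:
  "B \<in> sets M \<Longrightarrow>
    measure (cond_measure y) B = prob (background_event y \<inter> B) / prob (background_event y)"
  unfolding cond_measure_def using prob_background_event_pos[of y]
  by (intro measure_uniform_measure) (auto simp: emeasure_eq_measure)

text \<open>Each block contributes a factor for \<open>Y k = y k\<close>; their product is the
  probability of the background event and cancels against the normalisation.\<close>

lemma cond_measure_joint:
  "\<P>(\<omega> in cond_measure y. \<forall>k\<in>{1..l}. \<forall>j\<in>{1..d}. Z j k \<omega> \<in> A j k) =
    (\<Prod>k=1..l. \<Prod>j=1..d. \<P>(\<omega> in M. Z j k \<omega> \<in> A j k \<bar> Y k \<omega> = y k))"
proof -
  let ?S = "{\<omega> \<in> space M. \<forall>k\<in>{1..l}. \<forall>j\<in>{1..d}. Z j k \<omega> \<in> A j k}"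
  have "{\<omega> \<in> space M. Z j k \<omega> \<in> A j k} \<in> sets M" if "j \<in> {1..d}" "k \<in> {1..l}" for j k
    using measurable_sets[OF Z_measurable[OF that], of "A j k"] by (simp add: vimage_def Int_def conj_ac)
  then have "?S \<in> sets M"
    by (intro sets.sets_Collect_finite_All) auto
  then have "\<P>(\<omega> in cond_measure y. \<forall>k\<in>{1..l}. \<forall>j\<in>{1..d}. Z j k \<omega> \<in> A j k) =
      prob (background_event y \<inter> ?S) / prob (background_event y)"
    by (simp add: measure_cond_measure)
  also have "background_event y \<inter> ?S =
      {\<omega> \<in> space M. \<forall>k\<in>{1..l}. Y k \<omega> = y k \<and> (\<forall>j\<in>{1..d}. Z j k \<omega> \<in> A j k)}"
    by (auto simp: background_event_def)
  also have "prob \<dots> = prob (background_event y) *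
      (\<Prod>k=1..l. \<Prod>j=1..d. \<P>(\<omega> in M. Z j k \<omega> \<in> A j k \<bar> Y k \<omega> = y k))"
    unfolding prob_blocks prob_background_event prod.distrib[symmetric]
    by (intro prod.cong refl prob_block)
  finally show ?thesis
    using prob_background_event_pos[of y] by simp
qed

text \<open>Identifies the factors of the joint law as marginals of the conditional measure: the
  other blocks carry no information about \<open>Z j k\<close>.\<close>

lemma cond_measure_Z:
  assumes j: "j \<in> {1..d}" and k: "k \<in> {1..l}"
  shows "\<P>(\<omega> in cond_measure y. Z j k \<omega> \<in> A) = \<P>(\<omega> in M. Z j k \<omega> \<in> A \<bar> Y k \<omega> = y k)"
proof -
  \<comment> \<open>marginalise the joint law by leaving all other coordinates unconstrained\<close>
  define B where "B j' k' = (if j' = j \<and> k' = k then A else UNIV)" for j' k'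
  have one: "\<P>(\<omega> in M. Z j' k' \<omega> \<in> UNIV \<bar> Y k' \<omega> = y k') = 1" if "k' \<in> {1..l}" for j' k'
    using prob_Y_pos[OF that, of "y k'"] by (simp add: cond_prob_def)
  have "\<P>(\<omega> in cond_measure y. Z j k \<omega> \<in> A) =
      \<P>(\<omega> in cond_measure y. \<forall>k'\<in>{1..l}. \<forall>j'\<in>{1..d}. Z j' k' \<omega> \<in> B j' k')"
    using j k by (intro arg_cong[where f = "measure _"]) (auto simp: B_def)
  also have "\<dots> = (\<Prod>k'=1..l. \<Prod>j'=1..d. \<P>(\<omega> in M. Z j' k' \<omega> \<in> B j' k' \<bar> Y k' \<omega> = y k'))"
    by (rule cond_measure_joint)
  also have "\<dots> = (\<Prod>k'=1..l. \<Prod>j'=1..d.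
      if k' = k then if j' = j then \<P>(\<omega> in M. Z j k \<omega> \<in> A \<bar> Y k \<omega> = y k) else 1 else 1)"
    using one by (intro prod.cong refl) (auto simp: B_def)
  also have "\<dots> = (\<Prod>k'=1..l. if k' = k then
      \<Prod>j'=1..d. if j' = j then \<P>(\<omega> in M. Z j k \<omega> \<in> A \<bar> Y k \<omega> = y k) else 1 else 1)"
    by (intro prod.cong refl) auto
  also have "\<dots> = \<P>(\<omega> in M. Z j k \<omega> \<in> A \<bar> Y k \<omega> = y k)"
    using j k by simp
  finally show ?thesis .
qed

text \<open>The joint law is the product of its marginals, over the whole grid of index pairs at
  once, so rows and columns can be regrouped later.\<close>

lemma indep_Z:
  "prob_space.indep_vars (cond_measure y) (\<lambda>_. count_space UNIV) (\<lambda>(j, k). Z j k) ({1..d} \<times> {1..l})"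
proof -
  interpret N: prob_space "cond_measure y" by (rule prob_space_cond_measure)
  let ?I = "{1..d} \<times> {1..l}"
  \<comment> \<open>The power set is an intersection-stable generator containing the whole space, so
    over a finite index set the full product formula suffices.\<close>
  have "N.indep_vars (\<lambda>_. count_space UNIV) (\<lambda>(j, k). Z j k) ?I \<longleftrightarrow>
    (\<forall>A\<in>(\<Pi> i\<in>?I. UNIV). N.prob (\<Inter>i\<in>?I. (case i of (j, k) \<Rightarrow> Z j k) -` A i \<inter> space (cond_measure y)) =
      (\<Prod>i\<in>?I. N.prob ((case i of (j, k) \<Rightarrow> Z j k) -` A i \<inter> space (cond_measure y))))"
    using d_pos l_pos Z_measurable
    by (intro N.indep_vars_finite)
      (auto simp: Int_stable_def measurable_cong_sets[OF sets_cond_measure refl]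
        sets.sigma_sets_eq[of "count_space UNIV", simplified])
  moreover have "N.prob (\<Inter>i\<in>?I. (case i of (j, k) \<Rightarrow> Z j k) -` A i \<inter> space (cond_measure y)) =
      (\<Prod>i\<in>?I. N.prob ((case i of (j, k) \<Rightarrow> Z j k) -` A i \<inter> space (cond_measure y)))" for A
  proof -
    have "(\<Inter>i\<in>?I. (case i of (j, k) \<Rightarrow> Z j k) -` A i \<inter> space (cond_measure y)) =
      {\<omega> \<in> space (cond_measure y). \<forall>k\<in>{1..l}. \<forall>j\<in>{1..d}. Z j k \<omega> \<in> A (j, k)}"
      using d_pos l_pos by fastforce
    then have "N.prob (\<Inter>i\<in>?I. (case i of (j, k) \<Rightarrow> Z j k) -` A i \<inter> space (cond_measure y)) =
      \<P>(\<omega> in cond_measure y. \<forall>k\<in>{1..l}. \<forall>j\<in>{1..d}. Z j k \<omega> \<in> A (j, k))"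
      by (rule arg_cong)
    also have "\<dots> = (\<Prod>k=1..l. \<Prod>j=1..d. \<P>(\<omega> in cond_measure y. Z j k \<omega> \<in> A (j, k)))"
      unfolding cond_measure_joint by (intro prod.cong refl) (rule cond_measure_Z[symmetric])
    also have "\<dots> = (\<Prod>j=1..d. \<Prod>k=1..l. \<P>(\<omega> in cond_measure y. Z j k \<omega> \<in> A (j, k)))"
      by (rule prod.swap)
    also have "\<dots> = (\<Prod>(j, k)\<in>?I. \<P>(\<omega> in cond_measure y. Z j k \<omega> \<in> A (j, k)))"
      by (rule prod.cartesian_product)
    also have "\<dots> = (\<Prod>i\<in>?I. N.prob ((case i of (j, k) \<Rightarrow> Z j k) -` A i \<inter> space (cond_measure y)))"
      by (intro prod.cong refl) (auto simp: vimage_def Int_def conj_commute)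
    finally show ?thesis .
  qed
  ultimately show ?thesis by blast
qed

text \<open>The binomial masses at \<open>0, ..., y k\<close> add up to 1 by the binomial theorem,
  which leaves no mass above \<open>y k\<close>.\<close>

lemma AE_Z_le:
  assumes j: "j \<in> {1..d}" and k: "k \<in> {1..l}"
  shows "AE \<omega> in cond_measure y. Z j k \<omega> \<le> y k"
proof -
  interpret N: prob_space "cond_measure y" by (rule prob_space_cond_measure)
  note Z_measurable[OF j k, measurable]
  let ?q = "p j k" and ?n = "y k"
  have "\<P>(\<omega> in cond_measure y. Z j k \<omega> \<le> ?n) = N.prob (\<Union>z\<in>{..?n}. {\<omega> \<in> space M. Z j k \<omega> = z})"
    by (intro arg_cong[where f = "measure _"]) auto
  also have "\<dots> = (\<Sum>z\<le>?n. \<P>(\<omega> in cond_measure y. Z j k \<omega> \<in> {z}))"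
    by (subst N.finite_measure_finite_Union) (auto simp: disjoint_family_on_def)
  also have "\<dots> = (\<Sum>z\<le>?n. real (?n choose z) * ?q ^ z * (1 - ?q) ^ (?n - z))"
    unfolding cond_measure_Z[OF j k] by (intro sum.cong refl) (simp add: cond_binomial[OF j k])
  also have "\<dots> = (?q + (1 - ?q)) ^ ?n"
    by (rule binomial_ring[symmetric])
  finally have "\<P>(\<omega> in cond_measure y. Z j k \<omega> \<le> ?n) = 1"
    by simp
  then show ?thesis
    by (subst (asm) N.prob_Collect_eq_1) auto
qed

lemma AE_X_le:
  assumes j: "j \<in> {1..d}"
  shows "AE \<omega> in cond_measure y. X j \<omega> \<le> (\<Sum>k=1..l. y k)"
proof -
  have "AE \<omega> in cond_measure y. \<forall>k\<in>{1..l}. Z j k \<omega> \<le> y k"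
    by (intro AE_ball_countable[THEN iffD2] ballI AE_Z_le j) auto
  moreover have "AE \<omega> in cond_measure y. \<omega> \<in> space (cond_measure y)"
    by (rule AE_space)
  ultimately show ?thesis
    by eventually_elim (auto simp: X_eq[OF j] intro!: sum_mono)
qed

section \<open>The conditional laws of the components\<close>

text \<open>The rows of the grid are disjoint, and each sum is a function of one row. The sums stand
  in for \<open>X j\<close>, which agrees with them only on \<open>space M\<close>.\<close>

lemma indep_sum_Z:
  "prob_space.indep_vars (cond_measure y) (\<lambda>_. count_space UNIV) (\<lambda>j \<omega>. \<Sum>k=1..l. Z j k \<omega>) {1..d}"
proof -
  interpret N: prob_space "cond_measure y" by (rule prob_space_cond_measure)
  let ?K = "\<lambda>j. {j} \<times> {1..l}"
  have "N.indep_vars (\<lambda>j. PiM (?K j) (\<lambda>_. count_space UNIV))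
      (\<lambda>j \<omega>. restrict (\<lambda>i. (case i of (j, k) \<Rightarrow> Z j k) \<omega>) (?K j)) {1..d}"
    by (rule N.indep_vars_restrict[OF indep_Z]) (auto simp: disjoint_family_on_def)
  then have "N.indep_vars (\<lambda>_. count_space UNIV)
      (\<lambda>j \<omega>. \<Sum>k=1..l. restrict (\<lambda>i. (case i of (j, k) \<Rightarrow> Z j k) \<omega>) (?K j) (j, k)) {1..d}"
    by (rule N.indep_vars_compose2) measurable
  then show ?thesis by simp
qed

text \<open>One-element groups reindex row \<open>j\<close> of the grid by \<open>k\<close>, the
  form required for the iterated sum.\<close>

lemma indep_Z_row:
  assumes j: "j \<in> {1..d}"
  shows "prob_space.indep_vars (cond_measure y) (\<lambda>_. count_space UNIV) (Z j) {1..l}"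
proof -
  interpret N: prob_space "cond_measure y" by (rule prob_space_cond_measure)
  let ?K = "\<lambda>k. {(j, k)}"
  have "N.indep_vars (\<lambda>k. PiM (?K k) (\<lambda>_. count_space UNIV))
      (\<lambda>k \<omega>. restrict (\<lambda>i. (case i of (j, k) \<Rightarrow> Z j k) \<omega>) (?K k)) {1..l}"
    using j by (intro N.indep_vars_restrict[OF indep_Z]) (auto simp: disjoint_family_on_def)
  then have "N.indep_vars (\<lambda>_. count_space UNIV)
      (\<lambda>k \<omega>. restrict (\<lambda>i. (case i of (j, k) \<Rightarrow> Z j k) \<omega>) (?K k) (j, k)) {1..l}"
    by (rule N.indep_vars_compose2) measurable
  then show ?thesis by simp
qed

lemma cond_mass_eq: "cond_mass M l Y X j s y = \<P>(\<omega> in cond_measure y. X j \<omega> = s)" if "j \<in> {1..d}"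
proof -
  note measurable_X[OF that, measurable]
  show ?thesis
    by (subst space_cond_measure, subst measure_cond_measure)
      (auto simp: cond_mass_def cond_prob_def background_event_def Int_def conj_ac)
qed

lemma sum_cond_mass:
  assumes j: "j \<in> {1..d}"
  shows "(\<Sum>s=0..x. cond_mass M l Y X j s y) = \<P>(\<omega> in cond_measure y. X j \<omega> \<le> x)"
proof -
  interpret N: prob_space "cond_measure y" by (rule prob_space_cond_measure)
  note measurable_X[OF j, measurable]
  have "\<P>(\<omega> in cond_measure y. X j \<omega> \<le> x) = N.prob (\<Union>s\<in>{0..x}. {\<omega> \<in> space M. X j \<omega> = s})"
    by (intro arg_cong[where f = "measure _"]) auto
  also have "\<dots> = (\<Sum>s=0..x. \<P>(\<omega> in cond_measure y. X j \<omega> = s))"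
    by (subst N.finite_measure_finite_Union) (auto simp: disjoint_family_on_def)
  finally show ?thesis
    by (simp add: cond_mass_eq[OF j])
qed

lemma prob_X_in:
  "\<P>(\<omega> in cond_measure y. \<forall>j\<in>{1..d}. X j \<omega> \<in> A) = (\<Prod>j=1..d. \<P>(\<omega> in cond_measure y. X j \<omega> \<in> A))"
proof -
  interpret N: prob_space "cond_measure y" by (rule prob_space_cond_measure)
  have X_vimage: "(\<lambda>\<omega>. \<Sum>k=1..l. Z j k \<omega>) -` A \<inter> space M = {\<omega> \<in> space M. X j \<omega> \<in> A}"
    if "j \<in> {1..d}" for j
    using X_eq[OF that] by auto
  have "N.prob (\<Inter>j\<in>{1..d}. (\<lambda>\<omega>. \<Sum>k=1..l. Z j k \<omega>) -` A \<inter> space (cond_measure y)) =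
      (\<Prod>j=1..d. N.prob ((\<lambda>\<omega>. \<Sum>k=1..l. Z j k \<omega>) -` A \<inter> space (cond_measure y)))"
    using d_pos by (intro N.indep_varsD_finite[OF indep_sum_Z]) auto
  also have "(\<Inter>j\<in>{1..d}. (\<lambda>\<omega>. \<Sum>k=1..l. Z j k \<omega>) -` A \<inter> space (cond_measure y)) =
      {\<omega> \<in> space (cond_measure y). \<forall>j\<in>{1..d}. X j \<omega> \<in> A}"
    using d_pos X_vimage by fastforce
  also have "(\<Prod>j=1..d. N.prob ((\<lambda>\<omega>. \<Sum>k=1..l. Z j k \<omega>) -` A \<inter> space (cond_measure y))) =
      (\<Prod>j=1..d. \<P>(\<omega> in cond_measure y. X j \<omega> \<in> A))"
    by (intro prod.cong refl) (simp only: space_cond_measure X_vimage)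
  finally show ?thesis .
qed

section \<open>The explicit conditional mass function\<close>

text \<open>The iterated sum is evaluated from the empty prefix, \<open>k = 1\<close> and
  \<open>n = l - 1\<close>, under the conditional measure.\<close>

lemma cond_mass_eq_explicit_mass:
  assumes j: "j \<in> {1..d}"
  shows "cond_mass M l Y X j s y = explicit_mass M l Y Z j s y"
proof -
  interpret N: prob_space "cond_measure y" by (rule prob_space_cond_measure)
  \<comment> \<open>The separate conditionings on each \<open>Y k\<close> become probabilities under
    one common measure.\<close>
  have Z_eq: "\<P>(\<omega> in M. int (Z j k \<omega>) = v \<bar> Y k \<omega> = y k) = \<P>(\<omega> in cond_measure y. int (Z j k \<omega>) = v)"
    if "k \<in> {1..l}" for k v
    using cond_measure_Z[OF j that, of y "{n. int n = v}"] by simp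
  have "explicit_mass M l Y Z j s y = iterated_sum (lower_bound l s y) (upper_bound s y)
      (\<lambda>x. (\<Prod>k=1..<l. \<P>(\<omega> in cond_measure y. int (Z j k \<omega>) = x k)) *
            \<P>(\<omega> in cond_measure y. int (Z j l \<omega>) = int s - (\<Sum>i=1..<l. x i))) 1 (l - 1) (\<lambda>_. 0)"
    unfolding explicit_mass_def using l_pos
    by (intro arg_cong[where f = "\<lambda>g. iterated_sum _ _ g _ _ _"] ext arg_cong2[where f = "(*)"]
        prod.cong refl Z_eq) auto
  also have "\<dots> = \<P>(\<omega> in cond_measure y. int (\<Sum>k=1..l. Z j k \<omega>) = int s)"
    using l_pos by (subst N.iterated_sum_eq_prob_sum[OF indep_Z_row[OF j] AE_Z_le[OF j]]) auto
  also have "\<dots> = \<P>(\<omega> in cond_measure y. X j \<omega> = s)"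
    using X_eq[OF j] by (intro arg_cong[where f = "measure _"]) (auto simp del: of_nat_sum)
  finally show ?thesis
    by (simp add: cond_mass_eq[OF j])
qed

section \<open>The law of total probability\<close>

text \<open>The background events partition the space into countably many pieces, each of
  probability \<open>poisson_weight l \<theta> y > 0\<close>.\<close>

lemma has_sum_total_prob:
  assumes B: "B \<in> sets M"
  shows "((\<lambda>y. measure (cond_measure y) B * poisson_weight l \<theta> y) has_sum prob B) (nat_tuples l)"
proof -
  have "(\<Union>y\<in>nat_tuples l. background_event y \<inter> B) = B"
  proof (intro equalityI subsetI)
    fix \<omega> assume \<omega>: "\<omega> \<in> B"
    \<comment> \<open>Restricting to \<open>{1..l}\<close> makes the observed background vector
      extensional, hence a member of \<open>nat_tuples l\<close>.\<close>
    then have "\<omega> \<in> background_event (\<lambda>k\<in>{1..l}. Y k \<omega>)"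
      using sets.sets_into_space[OF B] by (auto simp: background_event_def)
    then show "\<omega> \<in> (\<Union>y\<in>nat_tuples l. background_event y \<inter> B)"
      using \<omega> by (intro UN_I[of "\<lambda>k\<in>{1..l}. Y k \<omega>"]) (auto simp: nat_tuples_def)
  qed auto
  moreover have "((\<lambda>y. prob (background_event y \<inter> B)) has_sum
      prob (\<Union>y\<in>nat_tuples l. background_event y \<inter> B)) (nat_tuples l)"
  proof (rule has_sum_measure_UN)
    show "countable (nat_tuples l)"
      unfolding nat_tuples_def by (rule countable_PiE) auto
    show "disjoint_family_on (\<lambda>y. background_event y \<inter> B) (nat_tuples l)"
      unfolding disjoint_family_on_def
    proof (intro ballI impI)
      fix y z assume yz: "y \<in> nat_tuples l" "z \<in> nat_tuples l" "y \<noteq> z"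
      \<comment> \<open>By extensionality, distinct tuples differ at an index inside
        \<open>{1..l}\<close>.\<close>
      then obtain k where "k \<in> {1..l}" "y k \<noteq> z k"
        unfolding nat_tuples_def by (metis PiE_ext)
      then show "background_event y \<inter> B \<inter> (background_event z \<inter> B) = {}"
        by (auto simp: background_event_def)
    qed
  qed (use B in auto)
  moreover have "prob (background_event y \<inter> B) = measure (cond_measure y) B * poisson_weight l \<theta> y" for y
    using prob_background_event_pos[of y] B
    by (simp add: measure_cond_measure prob_background_event_eq_poisson_weight)
  ultimately show ?thesis by simp
qed

text \<open>The conditional probability \<open>f\<close> is left abstract so that the maximum and
  the minimum are treated alike.\<close>

lemma total_prob_split:
  assumes B: "B \<in> sets M"
    and f: "\<And>y. measure (cond_measure y) B = f y"
    and low: "\<And>y. (\<Sum>k=1..l. y k) \<le> x \<Longrightarrow> f y = 1"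
  defines "low \<equiv> {y \<in> nat_tuples l. (\<Sum>k=1..l. y k) \<le> x}"
    and "high \<equiv> {y \<in> nat_tuples l. (\<Sum>k=1..l. y k) \<ge> x + 1}"
  shows "(\<lambda>y. f y * poisson_weight l \<theta> y) summable_on high"
    and "prob B = (\<Sum>y\<in>low. poisson_weight l \<theta> y) + (\<Sum>\<^sub>\<infinity>y\<in>high. f y * poisson_weight l \<theta> y)"
proof -
  let ?g = "\<lambda>y. f y * poisson_weight l \<theta> y"
  have total: "(?g has_sum prob B) (nat_tuples l)"
    using has_sum_total_prob[OF B] by (simp add: f)
  have tuples: "nat_tuples l = low \<union> high" "low \<inter> high = {}"
    by (auto simp: low_def high_def)
  \<comment> \<open>Every coordinate is at most the total, so \<open>low\<close> is finite and its
    part is an ordinary sum.\<close>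
  have "low \<subseteq> {1..l} \<rightarrow>\<^sub>E {..x}"
  proof
    fix y assume y: "y \<in> low"
    have "y k \<le> x" if "k \<in> {1..l}" for k
      using y member_le_sum[OF that, of y] by (auto simp: low_def)
    then show "y \<in> {1..l} \<rightarrow>\<^sub>E {..x}"
      using y by (auto simp: low_def nat_tuples_def PiE_iff)
  qed
  then have fin: "finite low"
    by (rule finite_subset) (auto intro: finite_PiE)
  show high: "?g summable_on high"
    by (rule summable_on_subset_banach[OF has_sum_imp_summable[OF total]]) (auto simp: tuples)
  have "prob B = (\<Sum>\<^sub>\<infinity>y\<in>low \<union> high. ?g y)"
    using infsumI[OF total] by (simp add: tuples)
  also have "\<dots> = (\<Sum>\<^sub>\<infinity>y\<in>low. ?g y) + (\<Sum>\<^sub>\<infinity>y\<in>high. ?g y)"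
    using fin high tuples by (intro infsum_Un_disjoint) auto
  also have "(\<Sum>\<^sub>\<infinity>y\<in>low. ?g y) = (\<Sum>y\<in>low. poisson_weight l \<theta> y)"
    using fin by (simp add: low_def low)
  finally show "prob B = (\<Sum>y\<in>low. poisson_weight l \<theta> y) + (\<Sum>\<^sub>\<infinity>y\<in>high. ?g y)" .
qed

section \<open>Conditional distribution functions of the extremes\<close>

lemma sum_cond_mass_eq_1:
  assumes j: "j \<in> {1..d}" and y: "(\<Sum>k=1..l. y k) \<le> x"
  shows "(\<Sum>s=0..x. cond_mass M l Y X j s y) = 1"
proof -
  interpret N: prob_space "cond_measure y" by (rule prob_space_cond_measure)
  note measurable_X[OF j, measurable]
  have "AE \<omega> in cond_measure y. X j \<omega> \<le> x"
    using AE_X_le[OF j, of y] by (rule AE_mp) (use y in auto)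
  then show ?thesis
    unfolding sum_cond_mass[OF j] by (intro N.prob_Collect_eq_1[THEN iffD2]) auto
qed

lemma prob_all_le:
  "\<P>(\<omega> in cond_measure y. \<forall>j\<in>{1..d}. X j \<omega> \<le> x) =
    (\<Prod>j=1..d. \<Sum>s=0..x. cond_mass M l Y X j s y)"
  using prob_X_in[of y "{..x}"] by (simp add: sum_cond_mass)

lemma sets_Collect_all_X: "{\<omega> \<in> space M. \<forall>j\<in>{1..d}. X j \<omega> \<in> A} \<in> sets M"
proof -
  have "{\<omega> \<in> space M. X j \<omega> \<in> A} \<in> sets M" if "j \<in> {1..d}" for j
    using measurable_sets[OF measurable_X[OF that], of A] by (simp add: vimage_def Int_def conj_commute)
  then show ?thesis
    by (intro sets.sets_Collect_finite_All) auto
qed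

text \<open>The complementary event, all components above \<open>x\<close>, factors over
  \<open>j\<close>.\<close>

lemma prob_ex_le:
  "\<P>(\<omega> in cond_measure y. \<exists>j\<in>{1..d}. X j \<omega> \<le> x) =
    1 - (\<Prod>j=1..d. 1 - (\<Sum>s=0..x. cond_mass M l Y X j s y))"
proof -
  interpret N: prob_space "cond_measure y" by (rule prob_space_cond_measure)
  have gt: "\<P>(\<omega> in cond_measure y. X j \<omega> \<in> {x<..}) = 1 - (\<Sum>s=0..x. cond_mass M l Y X j s y)"
    if j: "j \<in> {1..d}" for j
  proof -
    note measurable_X[OF j, measurable]
    have "\<P>(\<omega> in cond_measure y. \<not> X j \<omega> \<le> x) = 1 - \<P>(\<omega> in cond_measure y. X j \<omega> \<le> x)"
      by (rule N.prob_neg) measurable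
    then show ?thesis
      by (simp add: sum_cond_mass[OF j] not_le)
  qed
  have "\<P>(\<omega> in cond_measure y. \<exists>j\<in>{1..d}. X j \<omega> \<le> x) =
      \<P>(\<omega> in cond_measure y. \<not> (\<forall>j\<in>{1..d}. X j \<omega> \<in> {x<..}))"
    by (intro arg_cong[where f = "measure _"]) (auto simp: not_less)
  also have "\<dots> = 1 - \<P>(\<omega> in cond_measure y. \<forall>j\<in>{1..d}. X j \<omega> \<in> {x<..})"
    using sets_Collect_all_X[of "{x<..}"] by (intro N.prob_neg) simp
  finally show ?thesis
    unfolding prob_X_in by (simp only: gt cong: prod.cong)
qed

section \<open>Unconditional distribution functions of the extremes\<close>

lemma measurable_MAX: "(\<lambda>\<omega>. real (MAX j\<in>{1..d}. X j \<omega>)) \<in> borel_measurable M"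
  and measurable_MIN: "(\<lambda>\<omega>. real (MIN j\<in>{1..d}. X j \<omega>)) \<in> borel_measurable M"
proof -
  have X: "(\<lambda>\<omega>. real (X j \<omega>)) \<in> borel_measurable M" if "j \<in> {1..d}" for j
    using measurable_X[OF that] by measurable
  \<comment> \<open>The embedding \<open>real\<close> is monotone, so it commutes with extrema over
    a finite nonempty set.\<close>
  have "real (MAX j\<in>{1..d}. X j \<omega>) = (MAX j\<in>{1..d}. real (X j \<omega>))"
      "real (MIN j\<in>{1..d}. X j \<omega>) = (MIN j\<in>{1..d}. real (X j \<omega>))" for \<omega>
    using mono_Max_commute[of real "(\<lambda>j. X j \<omega>) ` {1..d}"] mono_Min_commute[of real "(\<lambda>j. X j \<omega>) ` {1..d}"] d_pos
    by (simp_all add: mono_def image_image)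
  then show "(\<lambda>\<omega>. real (MAX j\<in>{1..d}. X j \<omega>)) \<in> borel_measurable M"
    and "(\<lambda>\<omega>. real (MIN j\<in>{1..d}. X j \<omega>)) \<in> borel_measurable M"
    using X by (auto intro!: borel_measurable_Max borel_measurable_Min)
qed

lemma cdf_MAX:
  "cdf (distr M borel (\<lambda>\<omega>. real (MAX j\<in>{1..d}. X j \<omega>))) (real x) =
    \<P>(\<omega> in M. \<forall>j\<in>{1..d}. X j \<omega> \<le> x)"
proof -
  have "(\<lambda>\<omega>. real (MAX j\<in>{1..d}. X j \<omega>)) -` {..real x} \<inter> space M =
      {\<omega> \<in> space M. \<forall>j\<in>{1..d}. X j \<omega> \<le> x}"
    using d_pos by auto
  then show ?thesis
    unfolding cdf_def by (subst measure_distr[OF measurable_MAX]) auto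
qed

lemma cdf_MIN:
  "cdf (distr M borel (\<lambda>\<omega>. real (MIN j\<in>{1..d}. X j \<omega>))) (real x) =
    \<P>(\<omega> in M. \<exists>j\<in>{1..d}. X j \<omega> \<le> x)"
proof -
  have "(\<lambda>\<omega>. real (MIN j\<in>{1..d}. X j \<omega>)) -` {..real x} \<inter> space M =
      {\<omega> \<in> space M. \<exists>j\<in>{1..d}. X j \<omega> \<le> x}"
    using d_pos by (simp add: Min_le_iff vimage_def Int_def conj_commute)
  then show ?thesis
    unfolding cdf_def by (subst measure_distr[OF measurable_MIN]) auto
qed

end

theorem theorem3p3:
  fixes M :: "'a measure" and d l x :: nat
    and \<theta> :: "nat \<Rightarrow> real" and p :: "nat \<Rightarrow> nat \<Rightarrow> real"
    and Y :: "nat \<Rightarrow> 'a \<Rightarrow> nat" and Z :: "nat \<Rightarrow> nat \<Rightarrow> 'a \<Rightarrow> nat" and X :: "nat \<Rightarrow> 'a \<Rightarrow> nat"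
  assumes "thinning_dependence_poisson M d l \<theta> p Y Z X"
  defines "h \<equiv> cond_mass M l Y X"
    and "low \<equiv> {y \<in> nat_tuples l. (\<Sum>k=1..l. y k) \<le> x}"
    and "high \<equiv> {y \<in> nat_tuples l. (\<Sum>k=1..l. y k) \<ge> x + 1}"
  shows
    "(\<lambda>y. (\<Prod>j=1..d. \<Sum>s=0..x. h j s y) * poisson_weight l \<theta> y) summable_on high \<and>
     cdf (distr M borel (\<lambda>\<omega>. real (MAX j\<in>{1..d}. X j \<omega>))) (real x) =
       (\<Sum>y\<in>low. poisson_weight l \<theta> y) +
       (\<Sum>\<^sub>\<infinity>y\<in>high. (\<Prod>j=1..d. \<Sum>s=0..x. h j s y) * poisson_weight l \<theta> y) \<and>
     (\<lambda>y. (1 - (\<Prod>j=1..d. 1 - (\<Sum>s=0..x. h j s y))) * poisson_weight l \<theta> y) summable_on high \<and>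
     cdf (distr M borel (\<lambda>\<omega>. real (MIN j\<in>{1..d}. X j \<omega>))) (real x) =
       (\<Sum>y\<in>low. poisson_weight l \<theta> y) +
       (\<Sum>\<^sub>\<infinity>y\<in>high. (1 - (\<Prod>j=1..d. 1 - (\<Sum>s=0..x. h j s y))) * poisson_weight l \<theta> y) \<and>
     (\<forall>j\<in>{1..d}. \<forall>y\<in>nat_tuples l. \<forall>s\<le>(\<Sum>k=1..l. y k). h j s y = explicit_mass M l Y Z j s y)"
proof -
  interpret thinning_dependence_poisson M d l \<theta> p Y Z X by fact
  have all_sets: "{\<omega> \<in> space M. \<forall>j\<in>{1..d}. X j \<omega> \<le> x} \<in> sets M"
    using sets_Collect_all_X[of "{..x}"] by simp
  \<comment> \<open>The event for the minimum is measurable as the complement of an event of the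
    universal form.\<close>
  have "space M - {\<omega> \<in> space M. \<forall>j\<in>{1..d}. X j \<omega> \<in> {x<..}} \<in> sets M"
    by (intro sets.Diff sets.top sets_Collect_all_X)
  also have "space M - {\<omega> \<in> space M. \<forall>j\<in>{1..d}. X j \<omega> \<in> {x<..}} =
      {\<omega> \<in> space M. \<exists>j\<in>{1..d}. X j \<omega> \<le> x}"
    by (auto simp: not_less)
  finally have ex_sets: "{\<omega> \<in> space M. \<exists>j\<in>{1..d}. X j \<omega> \<le> x} \<in> sets M" .
  have one: "(\<Sum>s=0..x. h j s y) = 1" if "j \<in> {1..d}" "(\<Sum>k=1..l. y k) \<le> x" for j y
    unfolding h_def using that by (rule sum_cond_mass_eq_1)
  have "(\<lambda>y. (\<Prod>j=1..d. \<Sum>s=0..x. h j s y) * poisson_weight l \<theta> y) summable_on high"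
    "\<P>(\<omega> in M. \<forall>j\<in>{1..d}. X j \<omega> \<le> x) = (\<Sum>y\<in>low. poisson_weight l \<theta> y) +
       (\<Sum>\<^sub>\<infinity>y\<in>high. (\<Prod>j=1..d. \<Sum>s=0..x. h j s y) * poisson_weight l \<theta> y)"
    unfolding low_def high_def
    by (rule total_prob_split[OF all_sets]; use prob_all_le one in \<open>simp add: h_def\<close>)+
  moreover have "(\<lambda>y. (1 - (\<Prod>j=1..d. 1 - (\<Sum>s=0..x. h j s y))) * poisson_weight l \<theta> y) summable_on high"
    "\<P>(\<omega> in M. \<exists>j\<in>{1..d}. X j \<omega> \<le> x) = (\<Sum>y\<in>low. poisson_weight l \<theta> y) +
       (\<Sum>\<^sub>\<infinity>y\<in>high. (1 - (\<Prod>j=1..d. 1 - (\<Sum>s=0..x. h j s y))) * poisson_weight l \<theta> y)"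
    unfolding low_def high_def
    \<comment> \<open>On \<open>low\<close> every factor \<open>1 - 1\<close> vanishes; as
      \<open>d \<ge> 1\<close>, the product is 0 and the conditional probability is 1.\<close>
    by (rule total_prob_split[OF ex_sets]; use prob_ex_le one d_pos in \<open>simp add: h_def\<close>)+
  moreover have "\<forall>j\<in>{1..d}. \<forall>y\<in>nat_tuples l. \<forall>s\<le>(\<Sum>k=1..l. y k). h j s y = explicit_mass M l Y Z j s y"
    using cond_mass_eq_explicit_mass by (simp add: h_def)
  ultimately show ?thesis
    unfolding cdf_MAX cdf_MIN by blast
qed

end
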